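(* Let $A\in\mathbb{R}_+^{\infty\times\infty}$ be irreducible and let $r_{ess}(A)<r(A)$. Then $\sigma_p(A)=\{r(A)\}$ and each max-eigenvector of $A$ is strictly positive.
   Context: $\mathbb{R}_+^{\infty\times\infty}$ is the set of infinite matrices $A=(a_{ij})_{i,j\in\mathbb{N}}$ with non-negative real entries and $\|A\|:=\sup\{a_{ij}:i,j\in\mathbb{N}\}<\infty$, where $\mathbb{N}=\{1,2,\dots\}$. $\ell^\infty_+$ is the set of bounded non-negative sequences; $x\in\ell^\infty_+$ is strictly positive if $x_i>0$ for all $i\in\mathbb{N}$. In max algebra, $(A\otimes B)_{ij}=\sup_{k}a_{ik}b_{kj}$, $(A\otimes x)_i=\sup_j a_{ij}x_j$, and $A^k_\otimes$ is the $k$-th power of $A$ for $\otimes$. The max-algebra spectral radius is $r(A)=\lim_{k\to\infty}\|A^k_\otimes\|^{1/k}=\inf_k\|A^k_\otimes\|^{1/k}$ (the limit exists). The point spectrum $\sigma_p(A)$ is the set of all $t\ge0$ such that $A\otimes x=tx$ for some $x\in\ell^\infty_+$, $x\ne0$; such an $x$ is called a max-eigenvector of $A$. $A$ is irreducible if the directed graph with vertex set $\mathbb{N}$ and an edge from $i$ to $j$ whenever $a_{ij}>0$ is strongly connected (for all $i\ne j$ there is a path from $i$ to $j$). For $n\in\mathbb{N}$, $P_n(x_1,x_2,\dots)=(0,\dots,0,x_{n+1},x_{n+2},\dots)$ (first $n$ coordinates replaced by $0$), so $P_nAP_n$ is $A$ with all entries having row or column index $\le n$ replaced by $0$; $r_{ess}(A)=\lim_{n\to\infty}r(P_nAP_n)=\inf_{n}r(P_nAP_n)$.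 *)

theory Defs
  imports "HOL-Analysis.Analysis"
begin

text \<open>
  Infinite matrices and sequences are indexed by \<open>nat\<close>, so the index \<open>i = 1, 2, \<dots>\<close> of the
  mathematical text is represented by \<open>i - 1\<close>. All suprema below are suprema in the conditionally
  complete lattice of reals; they are meaningful because every family in question is bounded as soon
  as the matrices and sequences involved are nonnegative and bounded.
\<close>

type_synonym inf_matrix = "nat \<Rightarrow> nat \<Rightarrow> real"

definition nonneg_bounded_matrices :: "inf_matrix set" where
  "nonneg_bounded_matrices =
     {A. (\<forall>i j. 0 \<le> A i j) \<and> bdd_above (range (\<lambda>(i, j). A i j))}"

definition linf_nonneg :: "(nat \<Rightarrow> real) set" where
  "linf_nonneg = {x. (\<forall>i. 0 \<le> x i) \<and> bdd_above (range x)}"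

definition strictly_positive :: "(nat \<Rightarrow> real) \<Rightarrow> bool" where
  "strictly_positive x \<longleftrightarrow> (\<forall>i. 0 < x i)"

definition matrix_sup_norm :: "inf_matrix \<Rightarrow> real" where
  "matrix_sup_norm A = (SUP (i, j) \<in> UNIV. A i j)"

definition max_mult :: "inf_matrix \<Rightarrow> inf_matrix \<Rightarrow> inf_matrix" where
  "max_mult A B = (\<lambda>i j. SUP k. A i k * B k j)"

definition max_mult_vec :: "inf_matrix \<Rightarrow> (nat \<Rightarrow> real) \<Rightarrow> (nat \<Rightarrow> real)" where
  "max_mult_vec A x = (\<lambda>i. SUP j. A i j * x j)"

primrec max_power :: "inf_matrix \<Rightarrow> nat \<Rightarrow> inf_matrix" where
  "max_power A 0 = (\<lambda>i j. if i = j then 1 else 0)"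
| "max_power A (Suc k) = max_mult A (max_power A k)"

definition max_spectral_radius :: "inf_matrix \<Rightarrow> real" where
  "max_spectral_radius A = lim (\<lambda>k. root k (matrix_sup_norm (max_power A k)))"

definition max_eigenpair :: "inf_matrix \<Rightarrow> real \<Rightarrow> (nat \<Rightarrow> real) \<Rightarrow> bool" where
  "max_eigenpair A t x \<longleftrightarrow>
     0 \<le> t \<and> x \<in> linf_nonneg \<and> x \<noteq> (\<lambda>_. 0) \<and> max_mult_vec A x = (\<lambda>i. t * x i)"

definition max_point_spectrum :: "inf_matrix \<Rightarrow> real set" where
  "max_point_spectrum A = {t. \<exists>x. max_eigenpair A t x}"

definition max_eigenvector :: "inf_matrix \<Rightarrow> (nat \<Rightarrow> real) \<Rightarrow> bool" where
  "max_eigenvector A x \<longleftrightarrow> (\<exists>t. max_eigenpair A t x)"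

definition matrix_edges :: "inf_matrix \<Rightarrow> (nat \<times> nat) set" where
  "matrix_edges A = {(i, j). 0 < A i j}"

definition irreducible_matrix :: "inf_matrix \<Rightarrow> bool" where
  "irreducible_matrix A \<longleftrightarrow> (\<forall>i j. i \<noteq> j \<longrightarrow> (i, j) \<in> (matrix_edges A)\<^sup>+)"

definition tail_projection :: "nat \<Rightarrow> (nat \<Rightarrow> real) \<Rightarrow> (nat \<Rightarrow> real)" where
  "tail_projection n x = (\<lambda>i. if i < n then 0 else x i)"

text \<open>The matrix \<open>P\<^sub>n A P\<^sub>n\<close>, where \<open>P\<^sub>n\<close> is \<open>tail_projection n\<close>.\<close>

definition compression :: "nat \<Rightarrow> inf_matrix \<Rightarrow> inf_matrix" where
  "compression n A = (\<lambda>i j. if i < n \<or> j < n then 0 else A i j)"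

lemma compression_eq_projections:
  "max_mult_vec (compression n A) x = tail_projection n (max_mult_vec A (tail_projection n x))"
proof
  fix i
  have "(SUP j. (if j < n then 0 else A i j) * x j) = (SUP j. A i j * (if j < n then 0 else x j))"
    by (rule SUP_cong) simp_all
  then show "max_mult_vec (compression n A) x i =
      tail_projection n (max_mult_vec A (tail_projection n x)) i"
    by (cases "i < n") (simp_all add: max_mult_vec_def compression_def tail_projection_def)
qed

definition max_ess_spectral_radius :: "inf_matrix \<Rightarrow> real" where
  "max_ess_spectral_radius A = lim (\<lambda>n. max_spectral_radius (compression n A))"

end

theory Submission
  imports Defs
begin

text \<open>
  Since \<open>r\<^sub>e\<^sub>s\<^sub>s(A) < r = r(A)\<close>, there is an index \<open>v\<close> at which the spectral radius of the compressions
  drops: \<open>r(C\<^sub>v) = r > r(C\<^sub>v\<^sub>+\<^sub>1)\<close>. If the weights of the closed walks through \<open>v\<close>, normalised by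
  \<open>r\<close> to the power of the length, stayed below some \<open>s < 1\<close>, then splitting walks at their visits
  to \<open>v\<close> would produce a vector \<open>y\<close> bounded away from \<open>0\<close> and \<open>\<infinity>\<close> with \<open>C\<^sub>v \<otimes> y \<le> \<rho> y\<close> for some
  \<open>\<rho> < r\<close>, contradicting \<open>r(C\<^sub>v) = r\<close>. So these normalised weights have supremum \<open>1\<close>, and the
  \<open>v\<close>-th column of \<open>sup\<^sub>m r\<^sup>-\<^sup>m A\<^sup>m\<close> is an eigenvector for \<open>r\<close>; it is bounded because by
  irreducibility its first \<open>v + 1\<close> entries are finite, and walks that stay beyond \<open>v\<close> have bounded
  normalised weight. Any eigenvector \<open>x\<close> for \<open>t\<close> is strictly positive by irreducibility, hence
  \<open>(A\<^sup>m)\<^sub>v\<^sub>v \<le> t\<^sup>m\<close> for all \<open>m\<close>, which forces \<open>t \<ge> r\<close>.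
\<close>

section \<open>The max-linear operator of a matrix\<close>

lemma nonneg_bounded_matricesE:
  assumes "A \<in> nonneg_bounded_matrices"
  obtains a where "a > 0" "\<And>i j. 0 \<le> A i j" "\<And>i j. A i j \<le> a"
proof -
  obtain a where a: "\<And>i j. A i j \<le> a"
    using assms by (force simp: nonneg_bounded_matrices_def bdd_above_def)
  have "A i j \<le> max a 1" for i j using a[of i j] by simp
  then show ?thesis using that[of "max a 1"] assms by (auto simp: nonneg_bounded_matrices_def)
qed

lemma nonneg_bounded_matricesI:
  assumes "\<And>i j. 0 \<le> A i j" "\<And>i j. A i j \<le> a"
  shows "A \<in> nonneg_bounded_matrices"
  using assms by (auto simp: nonneg_bounded_matrices_def intro!: bdd_aboveI[of _ a])

lemma linf_nonnegE:
  assumes "x \<in> linf_nonneg"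
  obtains b where "b > 0" "\<And>i. 0 \<le> x i" "\<And>i. x i \<le> b"
proof -
  obtain b where b: "\<And>i. x i \<le> b"
    using assms by (force simp: linf_nonneg_def bdd_above_def)
  have "x i \<le> max b 1" for i using b[of i] by simp
  then show ?thesis using that[of "max b 1"] assms by (auto simp: linf_nonneg_def)
qed

lemma linf_nonnegI:
  assumes "\<And>i. 0 \<le> x i" "\<And>i. x i \<le> b"
  shows "x \<in> linf_nonneg"
  using assms by (auto simp: linf_nonneg_def intro!: bdd_aboveI[of _ b])

lemma max_mult_vec_upper:
  assumes "A \<in> nonneg_bounded_matrices" "x \<in> linf_nonneg"
  shows "A i j * x j \<le> max_mult_vec A x i"
proof -
  obtain a where a: "a > 0" "\<And>i j. 0 \<le> A i j" "\<And>i j. A i j \<le> a"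
    using nonneg_bounded_matricesE[OF assms(1)] by metis
  obtain b where b: "b > 0" "\<And>i. 0 \<le> x i" "\<And>i. x i \<le> b"
    using linf_nonnegE[OF assms(2)] by metis
  have "bdd_above (range (\<lambda>j. A i j * x j))"
    using a b by (intro bdd_aboveI[of _ "a * b"]) (auto intro!: mult_mono)
  then show ?thesis unfolding max_mult_vec_def by (rule cSUP_upper[OF UNIV_I])
qed

lemma max_mult_vec_least: "(\<And>j. A i j * x j \<le> c) \<Longrightarrow> max_mult_vec A x i \<le> c"
  unfolding max_mult_vec_def by (rule cSUP_least) auto

lemma max_mult_vec_linf:
  assumes "A \<in> nonneg_bounded_matrices" "x \<in> linf_nonneg"
  shows "max_mult_vec A x \<in> linf_nonneg"
proof -
  obtain a where a: "a > 0" "\<And>i j. 0 \<le> A i j" "\<And>i j. A i j \<le> a"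
    using nonneg_bounded_matricesE[OF assms(1)] by metis
  obtain b where b: "b > 0" "\<And>i. 0 \<le> x i" "\<And>i. x i \<le> b"
    using linf_nonnegE[OF assms(2)] by metis
  show ?thesis
  proof (rule linf_nonnegI)
    fix i
    have "0 \<le> A i 0 * x 0" using a b by simp
    also have "\<dots> \<le> max_mult_vec A x i" by (rule max_mult_vec_upper[OF assms])
    finally show "0 \<le> max_mult_vec A x i" .
    show "max_mult_vec A x i \<le> a * b"
      using a b by (intro max_mult_vec_least) (auto intro!: mult_mono)
  qed
qed

lemma funpow_max_mult_vec_linf:
  "A \<in> nonneg_bounded_matrices \<Longrightarrow> x \<in> linf_nonneg \<Longrightarrow> (max_mult_vec A ^^ m) x \<in> linf_nonneg"
  by (induction m) (auto intro: max_mult_vec_linf)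

lemma max_mult_vec_mono:
  assumes "\<And>i j. 0 \<le> A i j" "\<And>i j. A i j \<le> B i j" "B \<in> nonneg_bounded_matrices"
    and "\<And>i. 0 \<le> x i" "\<And>i. x i \<le> y i" "y \<in> linf_nonneg"
  shows "max_mult_vec A x i \<le> max_mult_vec B y i"
proof (rule max_mult_vec_least)
  fix j
  have "A i j * x j \<le> B i j * y j"
    using assms(4)[of j]
    by (intro mult_mono assms(2,5) order_trans[OF assms(1,2)])
  also have "\<dots> \<le> max_mult_vec B y i" by (rule max_mult_vec_upper) fact+
  finally show "A i j * x j \<le> max_mult_vec B y i" .
qed

lemma funpow_max_mult_vec_mono:
  assumes "\<And>i j. 0 \<le> A i j" "\<And>i j. A i j \<le> B i j" "B \<in> nonneg_bounded_matrices"
    and "\<And>i. 0 \<le> x i" "\<And>i. x i \<le> y i" "y \<in> linf_nonneg"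
  shows "(max_mult_vec A ^^ m) x i \<le> (max_mult_vec B ^^ m) y i"
proof (induction m arbitrary: i)
  case (Suc m)
  obtain a where a: "\<And>i j. B i j \<le> a"
    using nonneg_bounded_matricesE[OF assms(3)] by metis
  obtain b where b: "\<And>i. y i \<le> b"
    using linf_nonnegE[OF assms(6)] by metis
  have A: "A \<in> nonneg_bounded_matrices"
    by (intro nonneg_bounded_matricesI[of _ a] assms(1) order_trans[OF assms(2) a])
  have x: "x \<in> linf_nonneg"
    by (intro linf_nonnegI[of _ b] assms(4) order_trans[OF assms(5) b])
  have nn: "0 \<le> (max_mult_vec A ^^ m) x j" for j
    using funpow_max_mult_vec_linf[OF A x, of m] by (simp add: linf_nonneg_def)
  show ?case
    using max_mult_vec_mono[OF assms(1,2,3) nn Suc funpow_max_mult_vec_linf[OF assms(3,6)]] by simp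
qed (use assms in simp)

lemma max_mult_vec_scale:
  assumes "A \<in> nonneg_bounded_matrices" "x \<in> linf_nonneg" "0 \<le> c"
  shows "max_mult_vec A (\<lambda>j. c * x j) i = c * max_mult_vec A x i"
proof (rule antisym)
  show "max_mult_vec A (\<lambda>j. c * x j) i \<le> c * max_mult_vec A x i"
  proof (rule max_mult_vec_least)
    fix j
    show "A i j * (c * x j) \<le> c * max_mult_vec A x i"
      using mult_left_mono[OF max_mult_vec_upper[OF assms(1,2), of i j] assms(3)]
      by (simp add: algebra_simps)
  qed
  obtain b where b: "b > 0" "\<And>i. 0 \<le> x i" "\<And>i. x i \<le> b"
    using linf_nonnegE[OF assms(2)] by metis
  have cx: "(\<lambda>j. c * x j) \<in> linf_nonneg"
    using b assms(3) by (intro linf_nonnegI[of _ "c * b"]) (auto intro: mult_left_mono)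
  show "c * max_mult_vec A x i \<le> max_mult_vec A (\<lambda>j. c * x j) i"
  proof (cases "c = 0")
    case True
    then show ?thesis
      using max_mult_vec_linf[OF assms(1) cx] by (simp add: linf_nonneg_def)
  next
    case False
    then have "c > 0" using assms(3) by simp
    have "max_mult_vec A x i \<le> max_mult_vec A (\<lambda>j. c * x j) i / c"
    proof (rule max_mult_vec_least)
      fix j
      show "A i j * x j \<le> max_mult_vec A (\<lambda>j. c * x j) i / c"
        using max_mult_vec_upper[OF assms(1) cx, of i j] \<open>c > 0\<close> by (simp add: field_simps)
    qed
    then show ?thesis using \<open>c > 0\<close> by (simp add: field_simps)
  qed
qed

lemma scale_linf: "x \<in> linf_nonneg \<Longrightarrow> 0 \<le> c \<Longrightarrow> (\<lambda>i. c * x i) \<in> linf_nonneg"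
  by (erule linf_nonnegE) (rule linf_nonnegI, auto intro!: mult_left_mono)

lemma funpow_max_mult_vec_scale:
  assumes "A \<in> nonneg_bounded_matrices" "x \<in> linf_nonneg" "0 \<le> c"
  shows "(max_mult_vec A ^^ m) (\<lambda>j. c * x j) = (\<lambda>i. c * (max_mult_vec A ^^ m) x i)"
proof (induction m)
  case (Suc m)
  show ?case
    using max_mult_vec_scale[OF assms(1) funpow_max_mult_vec_linf[OF assms(1,2), of m] assms(3)]
    by (auto simp: Suc)
qed simp

text \<open>A subeigenvector \<open>y\<close> controls every iterate, by monotonicity and
  homogeneity. This later bounds the spectral radius of a compression from above.\<close>

lemma funpow_max_mult_vec_le_potential:
  assumes A: "A \<in> nonneg_bounded_matrices" and y: "y \<in> linf_nonneg"
    and \<rho>: "0 \<le> \<rho>" and Ay: "\<And>i. max_mult_vec A y i \<le> \<rho> * y i"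
  shows "(max_mult_vec A ^^ m) y i \<le> \<rho> ^ m * y i"
proof (induction m arbitrary: i)
  case (Suc m)
  have nn: "0 \<le> (max_mult_vec A ^^ m) y j" for j
    using funpow_max_mult_vec_linf[OF A y, of m] by (simp add: linf_nonneg_def)
  have A0: "0 \<le> A i j" for i j using A by (simp add: nonneg_bounded_matrices_def)
  have "(max_mult_vec A ^^ Suc m) y i \<le> max_mult_vec A (\<lambda>j. \<rho> ^ m * y j) i"
    using max_mult_vec_mono[OF A0 order_refl A nn Suc scale_linf[OF y]] \<rho> by simp
  also have "\<dots> = \<rho> ^ m * max_mult_vec A y i"
    using \<rho> by (intro max_mult_vec_scale A y) simp
  also have "\<dots> \<le> \<rho> ^ m * (\<rho> * y i)"
    using Ay \<rho> by (intro mult_left_mono) auto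
  finally show ?case by (simp add: algebra_simps)
qed simp

section \<open>Powers and the spectral radius\<close>

abbreviation unit_vec :: "nat \<Rightarrow> nat \<Rightarrow> real" where
  "unit_vec j \<equiv> (\<lambda>i. if i = j then 1 else 0)"

lemma unit_vec_linf: "unit_vec j \<in> linf_nonneg"
  by (rule linf_nonnegI[of _ 1]) auto

lemma one_linf: "(\<lambda>_. 1) \<in> linf_nonneg"
  by (rule linf_nonnegI[of _ 1]) auto

text \<open>Reduces powers to iterates of a single operator on vectors, where
  \<open>funpow_add\<close> does the work of associativity of \<open>max_mult\<close>.\<close>

lemma max_power_column: "max_power A m i j = (max_mult_vec A ^^ m) (unit_vec j) i"
  by (induction m arbitrary: i) (simp_all add: max_mult_def max_mult_vec_def)

lemma max_power_nonneg: "A \<in> nonneg_bounded_matrices \<Longrightarrow> 0 \<le> max_power A m i j"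
  using funpow_max_mult_vec_linf[OF _ unit_vec_linf] by (auto simp: max_power_column linf_nonneg_def)

lemma max_power_Suc_ge:
  assumes "A \<in> nonneg_bounded_matrices"
  shows "A i k * max_power A m k j \<le> max_power A (Suc m) i j"
  using max_mult_vec_upper[OF assms funpow_max_mult_vec_linf[OF assms unit_vec_linf], of i k m j]
  by (simp add: max_power_column del: max_power.simps)

lemma max_power_le_funpow:
  assumes A: "A \<in> nonneg_bounded_matrices" and x: "x \<in> linf_nonneg"
  shows "max_power A m i j * x j \<le> (max_mult_vec A ^^ m) x i"
proof -
  have A0: "0 \<le> A i j" for i j using A by (simp add: nonneg_bounded_matrices_def)
  have x0: "0 \<le> x i" for i using x by (simp add: linf_nonneg_def)
  have "max_power A m i j * x j = (max_mult_vec A ^^ m) (\<lambda>i. x j * unit_vec j i) i"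
    using funpow_max_mult_vec_scale[OF A unit_vec_linf x0] by (simp add: max_power_column)
  also have "\<dots> \<le> (max_mult_vec A ^^ m) x i"
    by (rule funpow_max_mult_vec_mono[OF A0 order_refl A _ _ x]) (auto simp: x0)
  finally show ?thesis .
qed

text \<open>With \<open>max_power_le_funpow\<close> this identifies the iterate as a supremum of
  walk weights times \<open>x\<close>. The induction generalises \<open>c\<close> because splitting
  off the first step divides the bound by its weight.\<close>

lemma funpow_le_max_power:
  assumes A: "A \<in> nonneg_bounded_matrices" and x: "x \<in> linf_nonneg"
    and "\<And>j. max_power A m i j * x j \<le> c"
  shows "(max_mult_vec A ^^ m) x i \<le> c"
  using assms(3)
proof (induction m arbitrary: i c)
  case 0
  then show ?case using 0[of i] by simp
next
  case (Suc m)
  have x0: "0 \<le> x i" for i using x by (simp add: linf_nonneg_def)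
  have "0 \<le> max_power A (Suc m) i 0 * x 0"
    using max_power_nonneg[OF A] x0 by (intro mult_nonneg_nonneg) blast+
  with Suc.prems[of 0] have c: "0 \<le> c" by linarith
  have "max_mult_vec A ((max_mult_vec A ^^ m) x) i \<le> c"
  proof (rule max_mult_vec_least)
    fix k
    show "A i k * (max_mult_vec A ^^ m) x k \<le> c"
    proof (cases "A i k > 0")
      case True
      have "max_power A m k j * x j \<le> c / A i k" for j
      proof -
        have "A i k * max_power A m k j * x j \<le> max_power A (Suc m) i j * x j"
          by (intro mult_right_mono max_power_Suc_ge A x0)
        also have "\<dots> \<le> c" by (rule Suc.prems)
        finally show ?thesis using True by (simp add: field_simps)
      qed
      from Suc.IH[OF this] show ?thesis using True by (simp add: field_simps)
    next
      case False
      then have "A i k = 0" using A by (auto simp: nonneg_bounded_matrices_def antisym_conv2)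
      then show ?thesis using c by simp
    qed
  qed
  then show ?case by simp
qed

text \<open>Concatenation of a walk from \<open>i\<close> to \<open>k\<close> with one from
  \<open>k\<close> to \<open>j\<close>.\<close>

lemma max_power_add_ge:
  assumes A: "A \<in> nonneg_bounded_matrices"
  shows "max_power A m i k * max_power A l k j \<le> max_power A (m + l) i j"
  using max_power_le_funpow[OF A funpow_max_mult_vec_linf[OF A unit_vec_linf]]
  by (simp add: max_power_column funpow_add)

lemma max_power_diag_power:
  assumes A: "A \<in> nonneg_bounded_matrices"
  shows "max_power A m i i ^ k \<le> max_power A (m * k) i i"
proof (induction k)
  case (Suc k)
  have "max_power A m i i ^ Suc k \<le> max_power A m i i * max_power A (m * k) i i"
    using Suc max_power_nonneg[OF A] by (auto intro: mult_left_mono)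
  also have "\<dots> \<le> max_power A (m * Suc k) i i"
    using max_power_add_ge[OF A, of m i i "m * k" i] by simp
  finally show ?case .
qed simp

section \<open>Norms of powers\<close>

text \<open>Iterating on the constant vector 1 yields the row suprema of the power, so norm
  estimates become estimates of one vector.\<close>

lemma matrix_sup_norm_power_le_iff:
  assumes A: "A \<in> nonneg_bounded_matrices"
  shows "matrix_sup_norm (max_power A m) \<le> c \<longleftrightarrow> (\<forall>i. (max_mult_vec A ^^ m) (\<lambda>_. 1) i \<le> c)"
proof -
  obtain b where b: "\<And>i. (max_mult_vec A ^^ m) (\<lambda>_. 1) i \<le> b"
    using linf_nonnegE[OF funpow_max_mult_vec_linf[OF A one_linf]] by metis
  have le: "max_power A m i j \<le> (max_mult_vec A ^^ m) (\<lambda>_. 1) i" for i j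
    using max_power_le_funpow[OF A one_linf, of m i j] by simp
  have bdd: "bdd_above (range (\<lambda>(i, j). max_power A m i j))"
    using order_trans[OF le b] by (intro bdd_aboveI[of _ b]) auto
  have "matrix_sup_norm (max_power A m) \<le> c \<longleftrightarrow> (\<forall>i j. max_power A m i j \<le> c)"
    unfolding matrix_sup_norm_def by (subst cSUP_le_iff[OF _ bdd]) auto
  also have "\<dots> \<longleftrightarrow> (\<forall>i. (max_mult_vec A ^^ m) (\<lambda>_. 1) i \<le> c)"
  proof safe
    fix i assume "\<forall>i j. max_power A m i j \<le> c"
    then show "(max_mult_vec A ^^ m) (\<lambda>_. 1) i \<le> c"
      by (intro funpow_le_max_power[OF A one_linf]) simp
  next
    fix i j assume "\<forall>i. (max_mult_vec A ^^ m) (\<lambda>_. 1) i \<le> c"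
    then show "max_power A m i j \<le> c" using le[of i j] by (auto intro: order_trans)
  qed
  finally show ?thesis .
qed

lemma funpow_one_le_norm:
  "A \<in> nonneg_bounded_matrices \<Longrightarrow>
    (max_mult_vec A ^^ m) (\<lambda>_. 1) i \<le> matrix_sup_norm (max_power A m)"
  using matrix_sup_norm_power_le_iff by blast

lemma norm_power_nonneg:
  assumes "A \<in> nonneg_bounded_matrices" shows "0 \<le> matrix_sup_norm (max_power A m)"
proof -
  have "0 \<le> (max_mult_vec A ^^ m) (\<lambda>_. 1) 0"
    using funpow_max_mult_vec_linf[OF assms one_linf, of m] by (simp add: linf_nonneg_def)
  then show ?thesis using funpow_one_le_norm[OF assms, of m 0] by linarith
qed

lemma funpow_le_norm:
  assumes A: "A \<in> nonneg_bounded_matrices" and x: "x \<in> linf_nonneg" and b: "\<And>i. x i \<le> b"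
  shows "(max_mult_vec A ^^ m) x i \<le> b * matrix_sup_norm (max_power A m)"
proof -
  have A0: "0 \<le> A i j" for i j using A by (simp add: nonneg_bounded_matrices_def)
  have x0: "0 \<le> x i" for i using x by (simp add: linf_nonneg_def)
  have b0: "0 \<le> b" using x0[of 0] b[of 0] by linarith
  have "(max_mult_vec A ^^ m) x i \<le> (max_mult_vec A ^^ m) (\<lambda>j. b * (\<lambda>_. 1) j) i"
    by (rule funpow_max_mult_vec_mono[OF A0 order_refl A x0 _ scale_linf[OF one_linf b0]])
      (simp add: b)
  also have "\<dots> = b * (max_mult_vec A ^^ m) (\<lambda>_. 1) i"
    by (simp only: funpow_max_mult_vec_scale[OF A one_linf b0])
  also have "\<dots> \<le> b * matrix_sup_norm (max_power A m)"
    by (intro mult_left_mono funpow_one_le_norm A b0)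
  finally show ?thesis .
qed

lemma norm_power_submult:
  assumes A: "A \<in> nonneg_bounded_matrices"
  shows "matrix_sup_norm (max_power A (m + l))
    \<le> matrix_sup_norm (max_power A m) * matrix_sup_norm (max_power A l)"
proof -
  have "(max_mult_vec A ^^ (m + l)) (\<lambda>_. 1) i
      \<le> matrix_sup_norm (max_power A m) * matrix_sup_norm (max_power A l)" for i
    using funpow_le_norm[OF A funpow_max_mult_vec_linf[OF A one_linf, of l]
        funpow_one_le_norm[OF A, of l], of m i]
    by (simp add: funpow_add mult.commute)
  then show ?thesis using matrix_sup_norm_power_le_iff[OF A] by blast
qed

section \<open>Submultiplicative sequences\<close>

text \<open>Splitting off blocks of length \<open>n\<close> costs \<open>\<rho> ^ n\<close> each;
  the remainder, shorter than \<open>n\<close>, is absorbed into \<open>K\<close>.\<close>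

lemma submult_geometric_bound:
  fixes f :: "nat \<Rightarrow> real"
  assumes f0: "\<And>m. 0 \<le> f m" and sub: "\<And>m l. f (m + l) \<le> f m * f l"
    and n: "n > 0" "f n \<le> \<rho> ^ n" and \<rho>: "\<rho> > 0"
  obtains K where "K > 0" "\<And>m. f m \<le> K * \<rho> ^ m"
proof -
  define K where "K = (\<Sum>l<n. f l / \<rho> ^ l) + 1"
  have fK: "f l \<le> K * \<rho> ^ l" if "l < n" for l
  proof -
    have "f l / \<rho> ^ l \<le> (\<Sum>l<n. f l / \<rho> ^ l)"
      using that f0 \<rho> by (intro member_le_sum) auto
    then have "f l / \<rho> ^ l \<le> K" by (simp add: K_def)
    then show ?thesis using \<rho> by (simp add: field_simps)
  qed
  have "K > 0" unfolding K_def using f0 \<rho> by (intro add_nonneg_pos sum_nonneg) auto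
  moreover have "f m \<le> K * \<rho> ^ m" for m
  proof (induction m rule: less_induct)
    case (less m)
    show ?case
    proof (cases "m < n")
      case False
      then have m: "m = n + (m - n)" by simp
      have "f m \<le> f n * f (m - n)" using sub[of n "m - n"] m by simp
      also have "\<dots> \<le> \<rho> ^ n * (K * \<rho> ^ (m - n))"
        using n False less[of "m - n"] f0 \<rho> by (intro mult_mono) auto
      also have "\<dots> = K * \<rho> ^ m" using m by (metis mult.left_commute power_add)
      finally show ?thesis .
    qed (rule fK)
  qed
  ultimately show ?thesis using that by blast
qed

text \<open>Fekete's argument: any \<rho> above the infimum is a geometric rate for \<open>f\<close>
  up to a constant \<open>K\<close>, and \<open>root m K\<close> tends to 1. The infimum starts at 1
  because \<open>root 0\<close> is constantly 0.\<close>

lemma submult_root_tendsto_Inf: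
  fixes f :: "nat \<Rightarrow> real"
  assumes f0: "\<And>m. 0 \<le> f m" and sub: "\<And>m l. f (m + l) \<le> f m * f l"
  shows "(\<lambda>m. root m (f m)) \<longlonglongrightarrow> (INF m\<in>{1..}. root m (f m))"
proof -
  define L where "L = (INF m\<in>{1..}. root m (f m))"
  have bdd: "bdd_below ((\<lambda>m. root m (f m)) ` {1..})"
    using f0 by (intro bdd_belowI[of _ 0]) auto
  have L0: "0 \<le> L" unfolding L_def using f0 by (intro cINF_greatest) auto
  have "(\<lambda>m. root m (f m)) \<longlonglongrightarrow> L"
  proof (rule order_tendstoI)
    fix a assume "a < L"
    have "a < root m (f m)" if "m \<ge> 1" for m
      using cINF_lower[OF bdd, of m] that \<open>a < L\<close> by (auto simp: L_def)
    then show "\<forall>\<^sub>F m in sequentially. a < root m (f m)"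
      by (auto simp: eventually_sequentially)
  next
    fix a assume "L < a"
    then obtain \<rho> where \<rho>: "L < \<rho>" "\<rho> < a" using dense by blast
    then obtain n where n: "n \<ge> 1" "root n (f n) < \<rho>"
      using cINF_less_iff[OF _ bdd, of \<rho>] by (auto simp: L_def)
    have \<rho>0: "\<rho> > 0" using L0 \<rho> by simp
    have "f n = root n (f n) ^ n" using n f0 by simp
    also have "\<dots> \<le> \<rho> ^ n" using n f0 by (intro power_mono) auto
    finally obtain K where K: "K > 0" "\<And>m. f m \<le> K * \<rho> ^ m"
      using submult_geometric_bound[OF f0 sub _ _ \<rho>0, of n] n by auto
    have "(\<lambda>m. root m K * \<rho>) \<longlonglongrightarrow> 1 * \<rho>" by (intro tendsto_mult LIMSEQ_root_const K tendsto_const)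
    then have "\<forall>\<^sub>F m in sequentially. root m K * \<rho> < a" using \<rho> by (intro order_tendstoD) simp_all
    then show "\<forall>\<^sub>F m in sequentially. root m (f m) < a"
      using eventually_ge_at_top[of 1]
    proof eventually_elim
      case (elim m)
      have "root m (f m) \<le> root m (K * \<rho> ^ m)" using elim K by simp
      also have "\<dots> = root m K * \<rho>" using elim \<rho>0 by (simp add: real_root_mult real_root_power_cancel)
      finally show ?case using elim by simp
    qed
  qed
  then show ?thesis by (simp add: L_def)
qed

section \<open>The spectral radius as a geometric growth rate\<close>

lemma max_spectral_radius_eq_INF:
  assumes "A \<in> nonneg_bounded_matrices"
  shows "max_spectral_radius A = (INF m\<in>{1..}. root m (matrix_sup_norm (max_power A m)))"
  unfolding max_spectral_radius_def
  by (intro limI submult_root_tendsto_Inf norm_power_nonneg norm_power_submult assms)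

lemma max_spectral_radius_tendsto:
  assumes "A \<in> nonneg_bounded_matrices"
  shows "(\<lambda>m. root m (matrix_sup_norm (max_power A m))) \<longlonglongrightarrow> max_spectral_radius A"
  unfolding max_spectral_radius_eq_INF[OF assms]
  by (intro submult_root_tendsto_Inf norm_power_nonneg norm_power_submult assms)

lemma max_spectral_radius_nonneg:
  assumes "A \<in> nonneg_bounded_matrices" shows "0 \<le> max_spectral_radius A"
  unfolding max_spectral_radius_eq_INF[OF assms]
  by (intro cINF_greatest) (auto intro: norm_power_nonneg[OF assms])

lemma max_spectral_radius_less_bound:
  assumes A: "A \<in> nonneg_bounded_matrices" and "max_spectral_radius A < \<rho>"
  obtains K where "K > 0" "\<And>m. matrix_sup_norm (max_power A m) \<le> K * \<rho> ^ m"
proof -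
  have "\<forall>\<^sub>F m in sequentially. root m (matrix_sup_norm (max_power A m)) < \<rho>"
    by (rule order_tendstoD(2)[OF max_spectral_radius_tendsto[OF A] assms(2)])
  then have "\<forall>\<^sub>F m in sequentially. root m (matrix_sup_norm (max_power A m)) < \<rho> \<and> m \<ge> 1"
    using eventually_ge_at_top[of 1] by (rule eventually_conj)
  then obtain n where n: "root n (matrix_sup_norm (max_power A n)) < \<rho>" "n \<ge> 1"
    by (auto simp: eventually_sequentially)
  have "matrix_sup_norm (max_power A n) = root n (matrix_sup_norm (max_power A n)) ^ n"
    using n norm_power_nonneg[OF A] by simp
  also have "\<dots> \<le> \<rho> ^ n" using n norm_power_nonneg[OF A] by (intro power_mono) auto
  finally have "matrix_sup_norm (max_power A n) \<le> \<rho> ^ n" .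
  moreover have "0 < n" "0 < \<rho>" using n max_spectral_radius_nonneg[OF A] assms(2) by auto
  ultimately show ?thesis
    using submult_geometric_bound[OF norm_power_nonneg[OF A] norm_power_submult[OF A]] that by metis
qed

lemma max_spectral_radius_le:
  assumes A: "A \<in> nonneg_bounded_matrices" and K: "K > 0" and \<rho>: "0 \<le> \<rho>"
    and le: "\<And>m. matrix_sup_norm (max_power A m) \<le> K * \<rho> ^ m"
  shows "max_spectral_radius A \<le> \<rho>"
proof -
  have "(\<lambda>m. root m K * \<rho>) \<longlonglongrightarrow> 1 * \<rho>" by (intro tendsto_mult LIMSEQ_root_const K tendsto_const)
  then have lim: "(\<lambda>m. root m K * \<rho>) \<longlonglongrightarrow> \<rho>" by simp
  have "root m (matrix_sup_norm (max_power A m)) \<le> root m K * \<rho>" if "m \<ge> 1" for m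
  proof -
    have "root m (matrix_sup_norm (max_power A m)) \<le> root m (K * \<rho> ^ m)" using that le by simp
    also have "\<dots> = root m K * \<rho>" using that \<rho> by (simp add: real_root_mult real_root_power_cancel)
    finally show ?thesis .
  qed
  then show ?thesis by (intro LIMSEQ_le[OF max_spectral_radius_tendsto[OF A] lim]) auto
qed

lemma geometric_growth_le:
  fixes c \<rho> K :: real
  assumes "\<And>k. c ^ k \<le> K * \<rho> ^ k" and \<rho>: "0 < \<rho>"
  shows "c \<le> \<rho>"
proof (rule ccontr)
  assume "\<not> c \<le> \<rho>"
  then have "1 < c / \<rho>" using \<rho> by simp
  then obtain k where "K < (c / \<rho>) ^ k" using real_arch_pow by blast
  then show False using assms(1)[of k] \<rho> by (simp add: field_simps power_divide)
qed

text \<open>Repeating a closed walk \<open>k\<close> times raises its weight to the power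
  \<open>k\<close>, while the norms grow at most like powers of any \<rho> above the spectral
  radius. Letting \<rho> decrease to the radius also covers radius 0.\<close>

lemma max_power_diag_le:
  assumes A: "A \<in> nonneg_bounded_matrices"
  shows "max_power A m i i \<le> max_spectral_radius A ^ m"
proof (rule tendsto_lowerbound)
  show "((\<lambda>\<rho>. \<rho> ^ m) \<longlongrightarrow> max_spectral_radius A ^ m) (at_right (max_spectral_radius A))"
    by (intro tendsto_intros)
  have "max_power A m i i \<le> \<rho> ^ m" if \<rho>: "max_spectral_radius A < \<rho>" for \<rho>
  proof -
    obtain K where K: "K > 0" "\<And>m. matrix_sup_norm (max_power A m) \<le> K * \<rho> ^ m"
      using max_spectral_radius_less_bound[OF A \<rho>] by blast
    have "max_power A m i i ^ k \<le> K * (\<rho> ^ m) ^ k" for k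
    proof -
      have "max_power A m i i ^ k \<le> max_power A (m * k) i i" by (rule max_power_diag_power[OF A])
      also have "\<dots> \<le> (max_mult_vec A ^^ (m * k)) (\<lambda>_. 1) i"
        using max_power_le_funpow[OF A one_linf, of "m * k" i i] by simp
      also have "\<dots> \<le> matrix_sup_norm (max_power A (m * k))" by (rule funpow_one_le_norm[OF A])
      also have "\<dots> \<le> K * (\<rho> ^ m) ^ k" using K(2)[of "m * k"] by (simp add: power_mult)
      finally show ?thesis .
    qed
    moreover have "0 < \<rho> ^ m" using max_spectral_radius_nonneg[OF A] \<rho> by simp
    ultimately show ?thesis by (rule geometric_growth_le)
  qed
  then show "\<forall>\<^sub>F \<rho> in at_right (max_spectral_radius A). max_power A m i i \<le> \<rho> ^ m"
    by (simp add: eventually_at_filter)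
qed simp

lemma max_spectral_radius_mono:
  assumes A0: "\<And>i j. 0 \<le> A i j" and AB: "\<And>i j. A i j \<le> B i j" and B: "B \<in> nonneg_bounded_matrices"
  shows "max_spectral_radius A \<le> max_spectral_radius B"
proof (rule LIMSEQ_le)
  obtain a where a: "\<And>i j. B i j \<le> a"
    using nonneg_bounded_matricesE[OF B] by metis
  have A: "A \<in> nonneg_bounded_matrices"
    by (intro nonneg_bounded_matricesI[of _ a] A0 order_trans[OF AB a])
  show "(\<lambda>m. root m (matrix_sup_norm (max_power A m))) \<longlonglongrightarrow> max_spectral_radius A"
    by (rule max_spectral_radius_tendsto[OF A])
  show "(\<lambda>m. root m (matrix_sup_norm (max_power B m))) \<longlonglongrightarrow> max_spectral_radius B"
    by (rule max_spectral_radius_tendsto[OF B])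
  have "matrix_sup_norm (max_power A m) \<le> matrix_sup_norm (max_power B m)" for m
    using order_trans[OF funpow_max_mult_vec_mono[OF A0 AB B _ _ one_linf] funpow_one_le_norm[OF B]]
    by (subst matrix_sup_norm_power_le_iff[OF A]) simp
  then show "\<exists>N. \<forall>m\<ge>N. root m (matrix_sup_norm (max_power A m)) \<le> root m (matrix_sup_norm (max_power B m))"
    by (intro exI[of _ 1]) auto
qed

section \<open>The normalised star of a matrix\<close>

text \<open>The Kleene star of \<open>A\<close> divided by \<rho>, applied to \<open>u\<close>. The
  geometric bound fixed in the context below makes the supremum finite.\<close>

definition max_star :: "inf_matrix \<Rightarrow> real \<Rightarrow> (nat \<Rightarrow> real) \<Rightarrow> nat \<Rightarrow> real" where
  "max_star A \<rho> u i = (SUP m. (max_mult_vec A ^^ m) u i / \<rho> ^ m)"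

context
  fixes A :: inf_matrix and \<rho> K :: real and u :: "nat \<Rightarrow> real"
  assumes A: "A \<in> nonneg_bounded_matrices" and u: "u \<in> linf_nonneg" and \<rho>: "0 < \<rho>"
    and K: "\<And>m i. (max_mult_vec A ^^ m) u i \<le> K * \<rho> ^ m"
begin

lemma max_star_upper: "(max_mult_vec A ^^ m) u i / \<rho> ^ m \<le> max_star A \<rho> u i"
  unfolding max_star_def using K \<rho>
  by (intro cSUP_upper bdd_aboveI[of _ K]) (auto simp: field_simps)

lemma max_star_ge: "u i \<le> max_star A \<rho> u i"
  using max_star_upper[of 0 i] by simp

lemma max_star_le: "max_star A \<rho> u i \<le> K"
  unfolding max_star_def using K \<rho> by (intro cSUP_least) (auto simp: field_simps)

lemma max_star_linf: "max_star A \<rho> u \<in> linf_nonneg"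
proof (rule linf_nonnegI[OF _ max_star_le])
  fix i
  have "0 \<le> u i" using u by (simp add: linf_nonneg_def)
  also have "\<dots> \<le> max_star A \<rho> u i" by (rule max_star_ge)
  finally show "0 \<le> max_star A \<rho> u i" .
qed

text \<open>Passes a termwise bound to the supremum by dividing by \<open>c\<close>. For
  \<open>c = 0\<close> the term \<open>m = 0\<close> already gives \<open>0 \<le> d\<close>.\<close>

lemma mult_max_star_le:
  assumes c: "0 \<le> c" and le: "\<And>m. c * (max_mult_vec A ^^ m) u i \<le> d * \<rho> ^ m"
  shows "c * max_star A \<rho> u i \<le> d"
proof (cases "c = 0")
  case True
  then show ?thesis using le[of 0] by simp
next
  case False
  then have "c > 0" using c by simp
  have "max_star A \<rho> u i \<le> d / c"
    unfolding max_star_def using le \<open>c > 0\<close> \<rho> by (intro cSUP_least) (auto simp: field_simps)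
  then show ?thesis using \<open>c > 0\<close> by (simp add: field_simps)
qed

text \<open>One more step shifts the index \<open>m\<close> to \<open>Suc m\<close>, which costs a
  factor \<rho>; so the star is a subeigenvector.\<close>

lemma max_mult_vec_max_star: "A i j * max_star A \<rho> u j \<le> \<rho> * max_star A \<rho> u i"
proof (rule mult_max_star_le)
  show "0 \<le> A i j" using A by (simp add: nonneg_bounded_matrices_def)
  fix m
  have "A i j * (max_mult_vec A ^^ m) u j \<le> (max_mult_vec A ^^ Suc m) u i"
    using max_mult_vec_upper[OF A funpow_max_mult_vec_linf[OF A u]] by simp
  also have "\<dots> \<le> \<rho> ^ Suc m * max_star A \<rho> u i"
    using max_star_upper[of "Suc m" i] \<rho> by (simp add: field_simps)
  finally show "A i j * (max_mult_vec A ^^ m) u j \<le> \<rho> * max_star A \<rho> u i * \<rho> ^ m"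
    by (simp add: algebra_simps)
qed

end

section \<open>Compressions\<close>

lemma compression_nonneg_bounded:
  assumes "A \<in> nonneg_bounded_matrices" shows "compression n A \<in> nonneg_bounded_matrices"
proof -
  obtain a where "a > 0" "\<And>i j. 0 \<le> A i j" "\<And>i j. A i j \<le> a"
    using nonneg_bounded_matricesE[OF assms] by metis
  then show ?thesis
    by (intro nonneg_bounded_matricesI[of _ a]) (auto simp: compression_def)
qed

lemma compression_mono:
  assumes "A \<in> nonneg_bounded_matrices" "m \<le> n"
  shows "compression n A i j \<le> compression m A i j"
  using assms by (auto simp: compression_def nonneg_bounded_matrices_def)

lemma compression_0: "compression 0 A = A"
  by (simp add: compression_def)

text \<open>The radii of the compressions decrease to a limit below the radius of \<open>A\<close>;
  \<open>v\<close> is the last index before the first drop.\<close>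

lemma ess_drop_index:
  assumes A: "A \<in> nonneg_bounded_matrices"
    and less: "max_ess_spectral_radius A < max_spectral_radius A"
  obtains v where "max_spectral_radius (compression v A) = max_spectral_radius A"
    "max_spectral_radius (compression (Suc v) A) < max_spectral_radius A"
proof -
  define f where "f n = max_spectral_radius (compression n A)" for n
  have C: "compression n A \<in> nonneg_bounded_matrices" for n
    by (rule compression_nonneg_bounded[OF A])
  have C0: "0 \<le> compression n A i j" for n i j
    using C[of n] by (simp add: nonneg_bounded_matrices_def)
  have mono: "f n \<le> f m" if "m \<le> n" for m n
    unfolding f_def by (intro max_spectral_radius_mono C0 compression_mono A that C)
  \<comment> \<open>The essential radius is defined through \<open>lim\<close>, so convergence has
    to be secured before its value can be used.\<close>
  have "decseq f" using mono by (auto simp: decseq_def)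
  moreover have "0 \<le> f n" for n unfolding f_def by (rule max_spectral_radius_nonneg[OF C])
  ultimately obtain L where L: "f \<longlonglongrightarrow> L" using decseq_convergent[of f 0] by blast
  then have "L < max_spectral_radius A"
    using less limI[OF L] by (simp add: max_ess_spectral_radius_def f_def[abs_def])
  then have ex: "\<exists>n. f n < f 0"
    using order_tendstoD(2)[OF L] by (auto simp: eventually_sequentially f_def compression_0)
  define n where "n = (LEAST n. f n < f 0)"
  have n: "f n < f 0" unfolding n_def using ex by (rule LeastI_ex)
  then obtain v where v: "n = Suc v" by (cases n) auto
  have "\<not> f v < f 0" using not_less_Least[of v "\<lambda>n. f n < f 0"] v by (simp add: n_def)
  then have "f v = f 0" using mono[of 0 v] by simp
  then show ?thesis using that[of v] n v by (simp add: f_def compression_0)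
qed

section \<open>Closed walks through the critical index\<close>

text \<open>Merges two bounds into one rate below \<open>R\<close>: the decay in \<open>q\<close>
  beats \<open>K\<close> for large \<open>m\<close>, and for the finitely many small
  \<open>m\<close> the factor \<open>s\<close> is spread over the exponents as a root.\<close>

lemma interpolate_geometric:
  fixes K q s R :: real
  assumes q: "0 < q" "q < R" and s: "0 < s" "s < 1" and K: "0 < K"
  obtains \<rho> where "q < \<rho>" "\<rho> < R"
    "\<And>m c. c \<le> s * R ^ m \<Longrightarrow> c \<le> K * q ^ m \<Longrightarrow> c \<le> \<rho> ^ m"
proof -
  define p where "p = (q + R) / 2"
  have p: "q < p" "p < R" "0 < p" using q by (auto simp: p_def)
  have "(\<lambda>m. (q / p) ^ m) \<longlonglongrightarrow> 0" using p q by (intro LIMSEQ_realpow_zero) auto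
  then have "\<forall>\<^sub>F m in sequentially. (q / p) ^ m < 1 / K"
    using K by (intro order_tendstoD(2)) auto
  then obtain N where N: "\<And>m. m \<ge> N \<Longrightarrow> (q / p) ^ m < 1 / K"
    by (auto simp: eventually_sequentially)
  have tail: "K * q ^ m \<le> p ^ m" if "m \<ge> N" for m
    using N[OF that] K p by (simp add: field_simps power_divide)
  \<comment> \<open>The exponent \<open>Suc N\<close> instead of \<open>N\<close> avoids a zeroth
    root.\<close>
  define \<sigma> where "\<sigma> = root (Suc N) s"
  have \<sigma>: "0 < \<sigma>" "\<sigma> < 1" "\<sigma> ^ Suc N = s" unfolding \<sigma>_def using s by (auto simp del: power_Suc)
  have head: "s * R ^ m \<le> (\<sigma> * R) ^ m" if "m \<le> N" for m
  proof -
    have "s \<le> \<sigma> ^ m" using \<sigma> that by (metis le_SucI less_imp_le power_decreasing)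
    then show ?thesis using q by (auto simp: power_mult_distrib intro: mult_right_mono)
  qed
  define \<rho> where "\<rho> = max p (\<sigma> * R)"
  have "q < \<rho>" "\<rho> < R" using p \<sigma> q by (auto simp: \<rho>_def)
  moreover have "c \<le> \<rho> ^ m" if "c \<le> s * R ^ m" "c \<le> K * q ^ m" for m c
  proof (cases "m \<ge> N")
    case True
    have "p ^ m \<le> \<rho> ^ m" using p by (intro power_mono) (auto simp: \<rho>_def)
    then show ?thesis using tail[OF True] that by linarith
  next
    case False
    have "(\<sigma> * R) ^ m \<le> \<rho> ^ m" using \<sigma> q by (intro power_mono) (auto simp: \<rho>_def)
    then show ?thesis using head[of m] False that by linarith
  qed
  ultimately show ?thesis using that by blast
qed

text \<open>
  The vector \<open>y\<close> of the proof collects the \<open>\<rho>\<close>-normalised weights of the walks that reach \<open>v\<close> for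
  the first time at their end; the term \<open>\<epsilon> z\<close> only keeps it away from \<open>0\<close>. The inequality
  \<open>C\<^sub>v \<otimes> y \<le> \<rho> y\<close> in row \<open>v\<close> says that first-return walks at \<open>v\<close> have normalised weight at most \<open>1\<close>.
\<close>

lemma closed_walk_near_spectral_radius:
  fixes A v
  defines "R \<equiv> max_spectral_radius (compression v A)"
  assumes A: "A \<in> nonneg_bounded_matrices"
    and drop: "max_spectral_radius (compression (Suc v) A) < R" and "s < 1"
  shows "\<exists>m\<ge>1. s * R ^ m < max_power A m v v"
proof (rule ccontr)
  assume neg: "\<not> ?thesis"
  define C where "C = compression (Suc v) A"
  have C: "C \<in> nonneg_bounded_matrices" unfolding C_def by (rule compression_nonneg_bounded[OF A])
  obtain q where q: "max_spectral_radius C < q" "q < R" using dense drop unfolding C_def by blast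
  have q0: "0 < q" using max_spectral_radius_nonneg[OF C] q by simp
  obtain K where K: "K > 0" "\<And>m. matrix_sup_norm (max_power C m) \<le> K * q ^ m"
    using max_spectral_radius_less_bound[OF C q(1)] by blast
  obtain a where a: "a > 0" "\<And>i j. 0 \<le> A i j" "\<And>i j. A i j \<le> a"
    using nonneg_bounded_matricesE[OF A] by metis
  \<comment> \<open>\<open>s\<close> may be nonpositive, whereas the interpolation requires a
    positive factor.\<close>
  define s' where "s' = max s (1/2)"
  have s': "0 < s'" "s' < 1" using \<open>s < 1\<close> by (auto simp: s'_def)
  have diag: "max_power A m v v \<le> s' * R ^ m" if "m \<ge> 1" for m
  proof -
    have "max_power A m v v \<le> s * R ^ m" using neg that by force
    also have "\<dots> \<le> s' * R ^ m" using q q0 by (intro mult_right_mono) (auto simp: s'_def)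
    finally show ?thesis .
  qed
  \<comment> \<open>\<open>b\<close> is the last step of a walk into \<open>v\<close>; each
    application of \<open>C\<close> prepends a step between indices beyond \<open>v\<close>.\<close>
  define b where "b k = A k v" for k
  have b: "b \<in> linf_nonneg" using a by (intro linf_nonnegI[of _ a]) (auto simp: b_def)
  have Cb: "(max_mult_vec C ^^ m) b k \<le> a * (K * q ^ m)" for m k
  proof -
    have "(max_mult_vec C ^^ m) b k \<le> a * matrix_sup_norm (max_power C m)"
      using a by (intro funpow_le_norm C b) (simp add: b_def)
    also have "\<dots> \<le> a * (K * q ^ m)" using a K by (intro mult_left_mono) auto
    finally show ?thesis .
  qed
  have C1: "(max_mult_vec C ^^ m) (\<lambda>_. 1) k \<le> K * q ^ m" for m k
    using funpow_one_le_norm[OF C] K(2) by (rule order_trans)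
  \<comment> \<open>The first summand serves the returns to \<open>v\<close> of length
    \<open>m + 2\<close>, the second the loop at \<open>v\<close> of length 1.\<close>
  define K' where "K' = a * a * K / q\<^sup>2 + a / q"
  have K': "K' > 0" using a K q0 by (auto simp: K'_def intro!: add_pos_pos)
  obtain \<rho> where \<rho>: "q < \<rho>" "\<rho> < R"
      "\<And>m c. c \<le> s' * R ^ m \<Longrightarrow> c \<le> K' * q ^ m \<Longrightarrow> c \<le> \<rho> ^ m"
    using interpolate_geometric[OF q0 q(2) s' K'] by metis
  have \<rho>0: "0 < \<rho>" using \<rho> q0 by simp
  have q\<rho>: "q ^ m \<le> \<rho> ^ m" for m using \<rho> q0 by (intro power_mono) auto
  have Avv: "A v v \<le> \<rho>"
  proof -
    have "A v v * max_power A 0 v v \<le> max_power A 1 v v"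
      using max_power_Suc_ge[OF A, of v v 0 v] by simp
    also have "\<dots> \<le> s' * R ^ 1" by (rule diag) simp
    finally have "A v v \<le> s' * R ^ 1" by simp
    moreover have "A v v \<le> K' * q ^ 1"
    proof -
      have "K' * q = a * a * K / q + a" using q0 by (simp add: K'_def field_simps power2_eq_square)
      moreover have "0 \<le> a * a * K / q" using a K q0 by simp
      ultimately show ?thesis using a(3)[of v v] by simp
    qed
    ultimately show ?thesis using \<rho>(3)[of "A v v" 1] by simp
  qed
  \<comment> \<open>Such a walk leaves \<open>v\<close>, makes \<open>m\<close> steps beyond
    \<open>v\<close> and returns. It is a closed walk of \<open>A\<close>, hence bounded by
    \<open>diag\<close>, and its middle part decays at rate \<open>q\<close>; interpolation combines
    both.\<close>
  have return: "A v k * (max_mult_vec C ^^ m) b k \<le> \<rho>\<^sup>2 * \<rho> ^ m" for m k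
  proof -
    have "(max_mult_vec C ^^ m) b k \<le> (max_mult_vec A ^^ m) (max_mult_vec A (unit_vec v)) k"
    proof (rule funpow_max_mult_vec_mono[OF _ _ A _ _ max_mult_vec_linf[OF A unit_vec_linf]])
      show "b i \<le> max_mult_vec A (unit_vec v) i" for i
        using max_mult_vec_upper[OF A unit_vec_linf, of i v v] by (simp add: b_def)
    qed (use a in \<open>auto simp: C_def compression_def b_def\<close>)
    also have "\<dots> = max_power A (Suc m) k v"
      by (simp only: max_power_column funpow_Suc_right o_apply)
    finally have "A v k * (max_mult_vec C ^^ m) b k \<le> A v k * max_power A (Suc m) k v"
      using a by (intro mult_left_mono) auto
    also have "\<dots> \<le> max_power A (m + 2) v v"
      using max_power_Suc_ge[OF A, of v k "Suc m" v] by (simp del: max_power.simps)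
    also have "\<dots> \<le> s' * R ^ (m + 2)" by (rule diag) simp
    finally have 1: "A v k * (max_mult_vec C ^^ m) b k \<le> s' * R ^ (m + 2)" .
    have "0 \<le> (max_mult_vec C ^^ m) b k"
      using funpow_max_mult_vec_linf[OF C b] by (simp add: linf_nonneg_def)
    then have "A v k * (max_mult_vec C ^^ m) b k \<le> a * (a * (K * q ^ m))"
      using a Cb by (intro mult_mono) auto
    also have "\<dots> = a * a * K / q\<^sup>2 * q ^ (m + 2)"
      using q0 by (simp add: power_add field_simps power2_eq_square)
    also have "\<dots> \<le> K' * q ^ (m + 2)"
      using a q0 by (intro mult_right_mono) (auto simp: K'_def)
    finally have "A v k * (max_mult_vec C ^^ m) b k \<le> \<rho> ^ (m + 2)" by (rule \<rho>(3)[OF 1])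
    then show ?thesis by (simp add: power2_eq_square mult.assoc)
  qed
  define z where "z = max_star C \<rho> (\<lambda>_. 1)"
  define h where "h = max_star C \<rho> b"
  have bound1: "(max_mult_vec C ^^ m) (\<lambda>_. 1) k \<le> K * \<rho> ^ m" for m k
  proof -
    have "K * q ^ m \<le> K * \<rho> ^ m" using K q\<rho> by simp
    with C1 show ?thesis by (rule order_trans)
  qed
  have boundb: "(max_mult_vec C ^^ m) b k \<le> (a * K) * \<rho> ^ m" for m k
  proof -
    have "a * (K * q ^ m) \<le> (a * K) * \<rho> ^ m" using a K q\<rho> by simp
    with Cb show ?thesis by (rule order_trans)
  qed
  note z_star = C one_linf \<rho>0 bound1 and h_star = C b \<rho>0 boundb
  have z: "1 \<le> z k" "z k \<le> K" for k
    unfolding z_def using max_star_ge[OF z_star] max_star_le[OF z_star] by blast+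
  have h: "b k \<le> h k" "h k \<le> a * K" for k
    unfolding h_def using max_star_ge[OF h_star] max_star_le[OF h_star] by blast+
  have Cz: "C k j * z j \<le> \<rho> * z k" for k j
    unfolding z_def by (rule max_mult_vec_max_star[OF z_star])
  have Ch: "C k j * h j \<le> \<rho> * h k" for k j
    unfolding h_def by (rule max_mult_vec_max_star[OF h_star])
  have Ah: "A v j * h j \<le> \<rho>\<^sup>2" for j
    unfolding h_def by (rule mult_max_star_le[OF h_star a(2) return])
  \<comment> \<open>Chosen so that the term \<epsilon> \<open>z\<close> satisfies the inequality in
    row \<open>v\<close>, where entries of \<open>A\<close> are at most \<open>a\<close> and those
    of \<open>z\<close> at most \<open>K\<close>.\<close>
  define \<epsilon> where "\<epsilon> = min 1 (\<rho> / (a * K))"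
  have \<epsilon>: "0 < \<epsilon>" "\<epsilon> \<le> 1" "a * K * \<epsilon> \<le> \<rho>"
  proof -
    show "0 < \<epsilon>" "\<epsilon> \<le> 1" using \<rho>0 a K by (auto simp: \<epsilon>_def)
    have "a * K * \<epsilon> \<le> a * K * (\<rho> / (a * K))" using a K by (intro mult_left_mono) (auto simp: \<epsilon>_def)
    then show "a * K * \<epsilon> \<le> \<rho>" using a K by simp
  qed
  \<comment> \<open>The value 1 at \<open>v\<close> is the empty walk; below \<open>v\<close> it is
    a filler, since those rows and columns of \<open>compression v A\<close> vanish. Dividing
    \<open>h\<close> by \<rho> accounts for the last step, which the exponent in \<open>h\<close>
    does not count.\<close>
  define y where "y k = (if k \<le> v then 1 else max (\<epsilon> * z k) (h k / \<rho>))" for k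
  define Y where "Y = max 1 (max (\<epsilon> * K) (a * K / \<rho>))"
  have y: "\<epsilon> \<le> y k" "y k \<le> Y" for k
  proof -
    have "\<epsilon> * 1 \<le> \<epsilon> * z k" "\<epsilon> * z k \<le> \<epsilon> * K"
      using z[of k] \<epsilon>(1) by (intro mult_left_mono; simp)+
    moreover have "h k / \<rho> \<le> a * K / \<rho>" using h \<rho>0 by (intro divide_right_mono) auto
    moreover have "1 \<le> Y" "\<epsilon> * K \<le> Y" "a * K / \<rho> \<le> Y" by (simp_all add: Y_def)
    ultimately show "\<epsilon> \<le> y k" "y k \<le> Y" using \<epsilon>(2) unfolding y_def by (auto split: if_splits)
  qed
  have y_linf: "y \<in> linf_nonneg"
    using y \<epsilon> by (intro linf_nonnegI[of _ Y]) (auto intro: order_trans[OF less_imp_le])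
  define M where "M = compression v A"
  have M: "M \<in> nonneg_bounded_matrices" unfolding M_def by (rule compression_nonneg_bounded[OF A])
  have My: "max_mult_vec M y k \<le> \<rho> * y k" for k
  proof (rule max_mult_vec_least)
    fix j
    have y0: "0 \<le> y k" using y(1)[of k] \<epsilon> by simp
    \<comment> \<open>The cases with row and column at least \<open>v\<close> are: the loop at
      \<open>v\<close>, leaving \<open>v\<close>, the final step into \<open>v\<close>, and a step
      beyond \<open>v\<close>.\<close>
    consider "k < v \<or> j < v" | "k = v" "j = v" | "k = v" "j > v" | "k > v" "j = v" | "k > v" "j > v"
      by linarith
    then show "M k j * y j \<le> \<rho> * y k"
    proof cases
      case 1
      then show ?thesis using y0 \<rho>0 by (auto simp: M_def compression_def)
    next
      case 2
      then show ?thesis using Avv by (simp add: M_def compression_def y_def)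
    next
      case 3
      have "A v j * (\<epsilon> * z j) \<le> a * (\<epsilon> * K)"
        using a z[of j] \<epsilon> by (intro mult_mono) auto
      also have "\<dots> \<le> \<rho>" using \<epsilon>(3) by (simp add: algebra_simps)
      finally have "A v j * (\<epsilon> * z j) \<le> \<rho>" .
      moreover have "A v j * (h j / \<rho>) \<le> \<rho>"
        using Ah[of j] \<rho>0 by (simp add: field_simps power2_eq_square)
      ultimately show ?thesis
        using 3 by (auto simp: M_def compression_def y_def max_def)
    next
      case 4
      have "\<rho> * (h k / \<rho>) \<le> \<rho> * y k"
        using 4 \<rho>0 by (intro mult_left_mono) (auto simp: y_def)
      then show ?thesis using 4 h(1)[of k] \<rho>0 by (simp add: M_def compression_def y_def[of v] b_def)
    next
      case 5
      have MC: "M k j = C k j" using 5 by (simp add: M_def C_def compression_def)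
      have "C k j * (\<epsilon> * z j) = \<epsilon> * (C k j * z j)" by simp
      also have "\<dots> \<le> \<epsilon> * (\<rho> * z k)" using Cz \<epsilon> by (intro mult_left_mono) auto
      also have "\<dots> = \<rho> * (\<epsilon> * z k)" by simp
      also have "\<dots> \<le> \<rho> * y k" using 5 \<rho>0 by (intro mult_left_mono) (auto simp: y_def)
      finally have 1: "C k j * (\<epsilon> * z j) \<le> \<rho> * y k" .
      have "C k j * (h j / \<rho>) = C k j * h j / \<rho>" by simp
      also have "\<dots> \<le> \<rho> * h k / \<rho>" using Ch \<rho>0 by (intro divide_right_mono) auto
      also have "\<dots> = \<rho> * (h k / \<rho>)" by simp
      also have "\<dots> \<le> \<rho> * y k" using 5 \<rho>0 by (intro mult_left_mono) (auto simp: y_def)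
      finally have 2: "C k j * (h j / \<rho>) \<le> \<rho> * y k" .
      show ?thesis using 1 2 5 MC by (auto simp: y_def[of j] max_def)
    qed
  qed
  \<comment> \<open>Since \<open>y\<close> lies between \<epsilon> and \<open>Y\<close>, the
    constant vector 1 is comparable to \<open>y\<close>, and the subeigenvector inequality bounds
    the norms at rate \<rho> below \<open>R\<close>.\<close>
  have "matrix_sup_norm (max_power M m) \<le> Y / \<epsilon> * \<rho> ^ m" for m
    unfolding matrix_sup_norm_power_le_iff[OF M]
  proof
    fix k
    have M0: "0 \<le> M i j" for i j using M by (simp add: nonneg_bounded_matrices_def)
    have \<epsilon>0: "0 \<le> 1 / \<epsilon>" using \<epsilon> by simp
    have "(max_mult_vec M ^^ m) (\<lambda>_. 1) k \<le> (max_mult_vec M ^^ m) (\<lambda>j. 1 / \<epsilon> * y j) k"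
      by (rule funpow_max_mult_vec_mono[OF M0 order_refl M _ _ scale_linf[OF y_linf \<epsilon>0]])
        (use y \<epsilon> in \<open>auto simp: field_simps\<close>)
    also have "\<dots> = 1 / \<epsilon> * (max_mult_vec M ^^ m) y k"
      by (simp only: funpow_max_mult_vec_scale[OF M y_linf \<epsilon>0])
    also have "\<dots> \<le> 1 / \<epsilon> * (\<rho> ^ m * y k)"
      using \<rho>0 by (intro mult_left_mono \<epsilon>0 funpow_max_mult_vec_le_potential M y_linf My) simp
    also have "\<dots> \<le> 1 / \<epsilon> * (\<rho> ^ m * Y)"
      using y \<rho>0 by (intro mult_left_mono \<epsilon>0) auto
    finally show "(max_mult_vec M ^^ m) (\<lambda>_. 1) k \<le> Y / \<epsilon> * \<rho> ^ m" by (simp add: algebra_simps)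
  qed
  moreover have "0 < Y / \<epsilon>" using \<epsilon> by (auto simp: Y_def)
  ultimately have "R \<le> \<rho>"
    using \<rho>0 max_spectral_radius_le[OF M] by (simp add: R_def M_def)
  then show False using \<rho> by simp
qed

section \<open>Eigenvectors\<close>

lemma max_power_pos_of_irreducible:
  assumes A: "A \<in> nonneg_bounded_matrices" and irr: "irreducible_matrix A"
  shows "\<exists>m. 0 < max_power A m i j"
proof (cases "i = j")
  case True
  then show ?thesis by (intro exI[of _ 0]) simp
next
  case False
  then have "(i, j) \<in> (matrix_edges A)\<^sup>*"
    using irr by (auto simp: irreducible_matrix_def intro: trancl_into_rtrancl)
  then show ?thesis
  proof (induction rule: converse_rtrancl_induct)
    case base
    then show ?case by (intro exI[of _ 0]) simp
  next
    case (step i k)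
    then obtain m where "0 < max_power A m k j" by blast
    then have "0 < A i k * max_power A m k j" using step by (simp add: matrix_edges_def)
    then show ?case using max_power_Suc_ge[OF A, of i k m j] by (intro exI[of _ "Suc m"]) linarith
  qed
qed

text \<open>Walks to \<open>v\<close> from the rows up to \<open>v\<close> are closed up by fixed
  return walks and then bounded by \<open>max_power_diag_le\<close>. The remaining rows follow by
  induction on the length, weighted by a subeigenvector \<open>z\<close> of the compression.\<close>

lemma max_power_column_bounded:
  assumes A: "A \<in> nonneg_bounded_matrices" and irr: "irreducible_matrix A"
    and drop: "max_spectral_radius (compression (Suc v) A) < max_spectral_radius A"
  obtains K where "\<And>m k. max_power A m k v \<le> K * max_spectral_radius A ^ m"
proof -
  define r where "r = max_spectral_radius A"
  define C where "C = compression (Suc v) A"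
  have C: "C \<in> nonneg_bounded_matrices" unfolding C_def by (rule compression_nonneg_bounded[OF A])
  have r0: "0 < r" using max_spectral_radius_nonneg[OF C] drop by (simp add: r_def C_def)
  obtain a where a: "a > 0" "\<And>i j. 0 \<le> A i j" "\<And>i j. A i j \<le> a"
    using nonneg_bounded_matricesE[OF A] by metis
  obtain Z where "\<And>m. matrix_sup_norm (max_power C m) \<le> Z * r ^ m"
    using max_spectral_radius_less_bound[OF C] drop by (metis C_def r_def)
  then have Z: "(max_mult_vec C ^^ m) (\<lambda>_. 1) k \<le> Z * r ^ m" for m k
    using funpow_one_le_norm[OF C] order_trans by blast
  note star = C one_linf r0 Z
  define z where "z = max_star C r (\<lambda>_. 1)"
  have z: "1 \<le> z k" "z k \<le> Z" for k
    unfolding z_def using max_star_ge[OF star] max_star_le[OF star] by blast+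
  have Cz: "C k j * z j \<le> r * z k" for k j
    unfolding z_def by (rule max_mult_vec_max_star[OF star])
  have "\<forall>k. \<exists>l. 0 < max_power A l v k"
    using max_power_pos_of_irreducible[OF A irr] by blast
  then obtain l where l: "\<And>k. 0 < max_power A (l k) v k" by metis
  \<comment> \<open>\<open>l k\<close> is the length of a return walk of positive weight from
    \<open>v\<close> to \<open>k\<close>.\<close>
  define B where "B k = r ^ l k / max_power A (l k) v k" for k
  have B0: "0 \<le> B k" for k using l[of k] r0 by (simp add: B_def)
  have B: "max_power A m k v \<le> B k * r ^ m" for m k
  proof -
    have "max_power A m k v * max_power A (l k) v k \<le> max_power A (m + l k) k k"
      by (rule max_power_add_ge[OF A])
    also have "\<dots> \<le> r ^ (m + l k)" unfolding r_def by (rule max_power_diag_le[OF A])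
    finally show ?thesis using l[of k] by (simp add: B_def field_simps power_add)
  qed
  define B' where "B' = (\<Sum>k\<le>v. B k)"
  have B': "0 \<le> B'" "\<And>k. k \<le> v \<Longrightarrow> B k \<le> B'"
    unfolding B'_def using B0 by (auto intro: sum_nonneg member_le_sum)
  have low: "max_power A m k v \<le> B' * r ^ m" if "k \<le> v" for m k
    using order_trans[OF B mult_right_mono[OF B'(2)[OF that]]] r0 by simp
  \<comment> \<open>The summands cover, in order, length 0, the rows up to \<open>v\<close>, and a
    step from beyond \<open>v\<close> to an index at most \<open>v\<close>.\<close>
  define K where "K = 1 + B' + a * B' / r"
  have K: "1 \<le> K" "B' \<le> K" "a * B' \<le> K * r" "0 \<le> K"
    using a B' r0 by (auto simp: K_def field_simps)
  have Kz: "K \<le> K * z k" for k using K z[of k] by simp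
  \<comment> \<open>With the factor \<open>z k\<close>, steps beyond \<open>v\<close> reproduce the
    same constant \<open>K\<close>, because \<open>C\<close> maps \<open>z\<close> below
    \<open>r\<close> times \<open>z\<close>; at the end \<open>z\<close> is replaced by its bound
    \<open>Z\<close>.\<close>
  have main: "max_power A m k v \<le> K * r ^ m * z k" for m k
  proof (induction m arbitrary: k)
    case 0
    then show ?case using order_trans[OF K(1) Kz[of k]] by (cases "k = v") auto
  next
    case (Suc m)
    show ?case
    proof (cases "k \<le> v")
      case True
      have "max_power A (Suc m) k v \<le> B' * r ^ Suc m" by (rule low[OF True])
      also have "\<dots> \<le> (K * z k) * r ^ Suc m"
        using order_trans[OF K(2) Kz[of k]] r0 by (intro mult_right_mono) simp_all
      finally show ?thesis by (simp add: algebra_simps)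
    next
      case False
      have "max_mult_vec A (\<lambda>k. max_power A m k v) k \<le> K * r ^ Suc m * z k"
      proof (rule max_mult_vec_least)
        fix j
        show "A k j * max_power A m j v \<le> K * r ^ Suc m * z k"
        proof (cases "j \<le> v")
          case True
          have "A k j * max_power A m j v \<le> a * (B' * r ^ m)"
            using a low[OF True] max_power_nonneg[OF A] by (intro mult_mono) auto
          also have "\<dots> = (a * B') * r ^ m" by simp
          also have "\<dots> \<le> (K * r) * r ^ m" using K r0 by (intro mult_right_mono) auto
          also have "\<dots> = K * r ^ Suc m" by simp
          also have "\<dots> \<le> K * z k * r ^ Suc m" using Kz[of k] r0 by (intro mult_right_mono) auto
          finally show ?thesis by (simp add: algebra_simps)
        next
          case jv: False
          have "A k j * max_power A m j v \<le> C k j * (K * r ^ m * z j)"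
            using False jv a Suc by (auto simp: C_def compression_def intro: mult_left_mono)
          also have "\<dots> = K * r ^ m * (C k j * z j)" by simp
          also have "\<dots> \<le> K * r ^ m * (r * z k)"
            using K r0 by (intro mult_left_mono Cz) auto
          finally show ?thesis by (simp add: algebra_simps)
        qed
      qed
      then show ?thesis by (simp add: max_mult_def max_mult_vec_def)
    qed
  qed
  have "max_power A m k v \<le> (K * Z) * r ^ m" for m k
  proof -
    have "K * r ^ m * z k \<le> K * r ^ m * Z" using z K r0 by (intro mult_left_mono) auto
    then show ?thesis using main[of m k] by (simp add: algebra_simps)
  qed
  then show ?thesis by (rule that[of "K * Z", folded r_def])
qed

text \<open>The star is a subeigenvector. Conversely, every term with \<open>m \<ge> 1\<close>
  starts with a step of \<open>A\<close> and so lies below the image of the star divided by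
  \<open>r\<close>; only the term \<open>m = 0\<close> at \<open>v\<close> needs
  \<open>crit\<close>.\<close>

lemma max_eigenpair_column_star:
  assumes A: "A \<in> nonneg_bounded_matrices" and r: "0 < r"
    and bound: "\<And>m k. max_power A m k v \<le> K * r ^ m"
    and crit: "\<And>s. s < 1 \<Longrightarrow> \<exists>m\<ge>1. s * r ^ m < max_power A m v v"
  shows "max_eigenpair A r (max_star A r (unit_vec v))"
proof -
  define x where "x = max_star A r (unit_vec v)"
  have "(max_mult_vec A ^^ m) (unit_vec v) k \<le> K * r ^ m" for m k
    using bound by (simp add: max_power_column)
  note star = A unit_vec_linf r this
  have x: "x \<in> linf_nonneg" unfolding x_def by (rule max_star_linf[OF star])
  have x_ge: "max_power A m k v / r ^ m \<le> x k" for m k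
    unfolding x_def max_power_column by (rule max_star_upper[OF star])
  have A0: "0 \<le> A i j" for i j using A by (simp add: nonneg_bounded_matrices_def)
  have step: "max_power A (Suc m) k v \<le> r ^ m * max_mult_vec A x k" for m k
  proof -
    have "max_mult_vec A (\<lambda>j. max_power A m j v) k \<le> max_mult_vec A (\<lambda>j. r ^ m * x j) k"
    proof (rule max_mult_vec_mono[OF A0 order_refl A])
      show "max_power A m i v \<le> r ^ m * x i" for i using x_ge[of m i] r by (simp add: field_simps)
    qed (use x r max_power_nonneg[OF A] in \<open>auto intro: scale_linf\<close>)
    also have "\<dots> = r ^ m * max_mult_vec A x k"
      using r by (intro max_mult_vec_scale A x) simp
    finally show ?thesis by (simp add: max_mult_def max_mult_vec_def)
  qed
  \<comment> \<open>If this failed, \<open>crit\<close> with \<open>s\<close> equal to the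
    normalised entry at \<open>v\<close> would give a closed walk heavier than \<open>step\<close>
    allows.\<close>
  have diag: "r \<le> max_mult_vec A x v"
  proof (rule ccontr)
    assume less: "\<not> r \<le> max_mult_vec A x v"
    then obtain m where m: "m \<ge> 1" "max_mult_vec A x v / r * r ^ m < max_power A m v v"
      using crit[of "max_mult_vec A x v / r"] r by auto
    then obtain m' where "m = Suc m'" by (cases m) auto
    then show False using m(2) step[of m' v] r by (simp add: field_simps)
  qed
  have "r * x k \<le> max_mult_vec A x k" for k
    unfolding x_def
  proof (rule mult_max_star_le[OF star], fold x_def)
    fix m
    show "r * (max_mult_vec A ^^ m) (unit_vec v) k \<le> max_mult_vec A x k * r ^ m"
    proof (cases m)
      case 0
      then show ?thesis
        using diag max_mult_vec_linf[OF A x] by (auto simp: linf_nonneg_def)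
    next
      case (Suc l)
      then show ?thesis
        using mult_left_mono[OF step[of l k], of r] r
        by (simp add: max_power_column algebra_simps del: max_power.simps)
    qed
  qed (use r in simp)
  moreover have "max_mult_vec A x k \<le> r * x k" for k
    unfolding x_def by (intro max_mult_vec_least max_mult_vec_max_star[OF star])
  ultimately have "max_mult_vec A x = (\<lambda>k. r * x k)" by (intro ext antisym)
  moreover have "x v \<noteq> 0" using x_ge[of 0 v] by simp
  ultimately show ?thesis using x r by (auto simp: max_eigenpair_def x_def[symmetric])
qed

section \<open>Positivity and uniqueness of the eigenvalue\<close>

text \<open>The eigenvalue equation carries positivity backwards along edges, and every index has a
  path to one where \<open>x\<close> is positive.\<close>

lemma max_eigenpair_strictly_positive:
  assumes A: "A \<in> nonneg_bounded_matrices" and irr: "irreducible_matrix A"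
    and eig: "max_eigenpair A t x"
  shows "strictly_positive x"
  unfolding strictly_positive_def
proof
  fix i
  have t: "0 \<le> t" and x: "x \<in> linf_nonneg" and Ax: "max_mult_vec A x = (\<lambda>i. t * x i)"
    and nz: "x \<noteq> (\<lambda>_. 0)" using eig by (auto simp: max_eigenpair_def)
  have x0: "0 \<le> x i" for i using x by (simp add: linf_nonneg_def)
  obtain j where "x j \<noteq> 0" using nz by blast
  then have j: "0 < x j" using x0[of j] by simp
  have "(i, j) \<in> (matrix_edges A)\<^sup>*"
    using irr by (cases "i = j") (auto simp: irreducible_matrix_def intro: trancl_into_rtrancl)
  then show "0 < x i"
  proof (induction rule: converse_rtrancl_induct)
    case (step i k)
    then have "0 < A i k * x k" by (simp add: matrix_edges_def)
    also have "\<dots> \<le> t * x i" using max_mult_vec_upper[OF A x, of i k] by (simp add: Ax)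
    finally show ?case using t x0[of i] by (simp add: zero_less_mult_iff)
  qed (rule j)
qed

lemma funpow_max_eigenpair:
  assumes "A \<in> nonneg_bounded_matrices" "max_eigenpair A t x"
  shows "(max_mult_vec A ^^ m) x = (\<lambda>i. t ^ m * x i)"
proof (induction m)
  case (Suc m)
  have "max_mult_vec A (\<lambda>i. t ^ m * x i) i = t ^ m * (t * x i)" for i
    using assms by (subst max_mult_vec_scale) (auto simp: max_eigenpair_def)
  then show ?case by (auto simp: Suc algebra_simps)
qed simp

text \<open>At an index with a positive entry the iterates grow like \<open>t ^ m\<close>, which the
  norms of the powers dominate up to a constant.\<close>

lemma max_eigenvalue_le_spectral_radius:
  assumes A: "A \<in> nonneg_bounded_matrices" and eig: "max_eigenpair A t x"
  shows "t \<le> max_spectral_radius A"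
proof (rule dense_ge)
  fix \<rho> assume \<rho>: "max_spectral_radius A < \<rho>"
  obtain K where K: "K > 0" "\<And>m. matrix_sup_norm (max_power A m) \<le> K * \<rho> ^ m"
    using max_spectral_radius_less_bound[OF A \<rho>] by blast
  have x: "x \<in> linf_nonneg" using eig by (simp add: max_eigenpair_def)
  obtain b where b: "b > 0" "\<And>i. 0 \<le> x i" "\<And>i. x i \<le> b"
    using linf_nonnegE[OF x] by metis
  obtain i where "x i \<noteq> 0" using eig by (auto simp: max_eigenpair_def)
  then have i: "0 < x i" using b(2)[of i] by simp
  have "t ^ m \<le> b * K / x i * \<rho> ^ m" for m
  proof -
    have "t ^ m * x i \<le> b * matrix_sup_norm (max_power A m)"
      using funpow_le_norm[OF A x b(3), of m i] by (simp add: funpow_max_eigenpair[OF A eig])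
    also have "\<dots> \<le> b * (K * \<rho> ^ m)" using b K by (intro mult_left_mono) auto
    finally show ?thesis using i by (simp add: field_simps)
  qed
  moreover have "0 < \<rho>" using max_spectral_radius_nonneg[OF A] \<rho> by simp
  ultimately show "t \<le> \<rho>" by (rule geometric_growth_le)
qed

theorem theorem3p14:
  fixes A :: inf_matrix
  assumes "A \<in> nonneg_bounded_matrices"
    and "irreducible_matrix A"
    and "max_ess_spectral_radius A < max_spectral_radius A"
  shows "max_point_spectrum A = {max_spectral_radius A}
    \<and> (\<forall>x. max_eigenvector A x \<longrightarrow> strictly_positive x)"
proof -
  note A = assms(1) and irr = assms(2)
  define r where "r = max_spectral_radius A"
  obtain v where v: "max_spectral_radius (compression v A) = r"
      "max_spectral_radius (compression (Suc v) A) < r"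
    using ess_drop_index[OF A assms(3)] by (metis r_def)
  have crit: "\<exists>m\<ge>1. s * r ^ m < max_power A m v v" if "s < 1" for s
    using closed_walk_near_spectral_radius[OF A, of v s] v that by simp
  have r0: "0 < r"
    using max_spectral_radius_nonneg[OF compression_nonneg_bounded[OF A], of "Suc v"] v by simp
  obtain K where "\<And>m k. max_power A m k v \<le> K * r ^ m"
    using max_power_column_bounded[OF A irr] v(2) by (metis r_def)
  then have "max_eigenpair A r (max_star A r (unit_vec v))"
    using crit by (rule max_eigenpair_column_star[OF A r0])
  then have "r \<in> max_point_spectrum A" by (auto simp: max_point_spectrum_def)
  moreover have "t = r" if eig: "max_eigenpair A t x" for t x
  proof (rule antisym)
    show "t \<le> r" unfolding r_def by (rule max_eigenvalue_le_spectral_radius[OF A eig])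
    show "r \<le> t"
    proof (rule ccontr)
      assume "\<not> r \<le> t"
      then have "t / r < 1" using r0 by simp
      then obtain m where m: "m \<ge> 1" "t / r * r ^ m < max_power A m v v" using crit by blast
      have t: "0 \<le> t" and x: "x \<in> linf_nonneg" using eig by (auto simp: max_eigenpair_def)
      have xv: "0 < x v"
        using max_eigenpair_strictly_positive[OF A irr eig] by (simp add: strictly_positive_def)
      have "max_power A m v v * x v \<le> t ^ m * x v"
        using max_power_le_funpow[OF A x, of m v v] by (simp add: funpow_max_eigenpair[OF A eig])
      then have "max_power A m v v \<le> t ^ m" using xv by simp
      also have "t ^ m = (t / r) ^ m * r ^ m" using r0 by (simp add: power_divide)
      \<comment> \<open>Here \<open>m \<ge> 1\<close> matters: a positive power of a ratio below 1
        does not exceed the ratio, contradicting the choice of \<open>m\<close> with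
        \<open>s = t / r\<close>.\<close>
      also have "(t / r) ^ m * r ^ m \<le> t / r * r ^ m"
        using m(1) t r0 \<open>t / r < 1\<close> power_decreasing[of 1 m "t / r"]
        by (intro mult_right_mono) auto
      finally show False using m(2) by simp
    qed
  qed
  ultimately have "max_point_spectrum A = {r}" by (auto simp: max_point_spectrum_def)
  then show ?thesis
    using max_eigenpair_strictly_positive[OF A irr] by (auto simp: r_def max_eigenvector_def)
qed

end
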